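(* Let $\mathbf{k}$ be an infinite commutative ring with identity, endowed with the discrete topology, and let the group $\mathcal{J}(\mathbf{k})$ be endowed with the inverse limit topology. Then $\mathcal{J}(\mathbf{k})$ does not admit any embedding into a locally compact group.
   Context: For a commutative ring $\mathbf{k}$ with identity, $\mathcal{J}(\mathbf{k})$ is the set of formal power series $f(x)=x+\alpha_1x^2+\alpha_2x^3+\dots = x(1+\alpha_1 x+\alpha_2x^2+\dots)$, $\alpha_n\in\mathbf{k}$; it is a group under substitution $f\circ g=f(g(x))$. For $n\ge 1$, $\mathcal{J}_n(\mathbf{k})=\{f\in\mathcal{J}(\mathbf{k}) : \alpha_1=\dots=\alpha_n=0\}$, a normal subgroup. If $\mathbf{k}$ is a topological ring, $\mathcal{J}(\mathbf{k})$ carries the product topology transported by the bijection $\mathbf{k}^{\aleph_0}\to\mathcal{J}(\mathbf{k})$, $(\alpha_1,\alpha_2,\dots)\mapsto x(1+\alpha_1x+\alpha_2x^2+\dots)$; it coincides with the inverse limit topology of the groups $\mathcal{J}^m(\mathbf{k})=\mathcal{J}(\mathbf{k})/\mathcal{J}_m(\mathbf{k})$ and makes $\mathcal{J}(\mathbf{k})$ a topological group. When $\mathbf{k}$ is discrete, the subgroups $\mathcal{J}_n(\mathbf{k})$ form a base of neighborhoods of the identity. A topological group $G$ is embedded into a topological group $H$ if there is a continuous injective group homomorphism $\phi:G\to H$ that is a homeomorphism onto its image (with the subspace topology). Locally compact groups are Hausdorff. *)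

theory Defs
  imports
    "HOL-Analysis.Analysis"
    "HOL-Algebra.Group"
    "HOL-Computational_Algebra.Formal_Power_Series"
begin

unbundle fps_syntax

definition substitution_group :: "'k::comm_ring_1 fps monoid" where
  "substitution_group =
    \<lparr>carrier = {f. f $ 0 = 0 \<and> f $ 1 = 1}, mult = (\<lambda>f g. f oo g), one = fps_X\<rparr>"

text \<open>
  Writing \<open>f = x (1 + \<alpha>\<^sub>1 x + \<alpha>\<^sub>2 x\<^sup>2 + \<dots>)\<close>, the sequence \<open>\<alpha>\<^sub>1, \<alpha>\<^sub>2, \<dots>\<close> is indexed from 0 below,
  so entry \<open>n\<close> is the coefficient of \<open>x^(n + 2)\<close>.
\<close>

definition substitution_coords :: "'k::comm_ring_1 fps \<Rightarrow> nat \<Rightarrow> 'k" where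
  "substitution_coords f = (\<lambda>n. f $ (n + 2))"

text \<open>
  The coordinate map is a bijection from the carrier to all sequences, so the pullback
  is the transport of the product topology along it. The argument \<open>K\<close> is the topology of the
  coefficient ring (with \<^term>\<open>topspace K = UNIV\<close>).
\<close>

lemma bij_betw_substitution_coords:
  "bij_betw substitution_coords (carrier (substitution_group :: 'k::comm_ring_1 fps monoid)) UNIV"
proof (rule bij_betwI[where g = "\<lambda>a. Abs_fps (\<lambda>n. if n = 0 then 0 else if n = 1 then 1 else a (n - 2))"])
  fix f :: "'k fps"
  assume "f \<in> carrier substitution_group"
  then show "Abs_fps (\<lambda>n. if n = 0 then 0 else if n = 1 then 1 else substitution_coords f (n - 2)) = f"
    by (auto simp: substitution_group_def substitution_coords_def fps_eq_iff
        intro!: arg_cong[where f = "fps_nth f"])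
qed (auto simp: substitution_group_def substitution_coords_def)

definition substitution_topology :: "'k::comm_ring_1 topology \<Rightarrow> 'k fps topology" where
  "substitution_topology K =
    pullback_topology (carrier substitution_group) substitution_coords
      (product_topology (\<lambda>_. K) UNIV)"

text \<open>
  For discrete coefficients this is the inverse limit topology: the open sets are generated by
  the classes of series that agree up to a given order.
\<close>

lemma openin_substitution_topology_discrete:
  fixes U :: "'k::comm_ring_1 fps set"
  shows "openin (substitution_topology (discrete_topology UNIV)) U \<longleftrightarrow>
    U \<subseteq> carrier substitution_group \<and>
    (\<forall>f\<in>U. \<exists>m. \<forall>g\<in>carrier substitution_group. (\<forall>i\<le>m. g $ i = f $ i) \<longrightarrow> g \<in> U)"
    (is "?L \<longleftrightarrow> ?R")
proof
  assume ?L
  then obtain V where V: "openin (product_topology (\<lambda>_. discrete_topology UNIV) UNIV) V"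
    and U: "U = substitution_coords -` V \<inter> carrier substitution_group"
    by (auto simp: substitution_topology_def openin_pullback_topology)
  have "\<exists>m. \<forall>g\<in>carrier substitution_group. (\<forall>i\<le>m. g $ i = f $ i) \<longrightarrow> g \<in> U" if "f \<in> U" for f
  proof -
    from that U have "substitution_coords f \<in> V" by auto
    then obtain W where W: "finite {i. W i \<noteq> (UNIV :: 'k set)}"
      "substitution_coords f \<in> PiE UNIV W" "PiE UNIV W \<subseteq> V"
      using V by (force simp: openin_product_topology_alt)
    from W(1) obtain m where m: "\<forall>i. W i \<noteq> UNIV \<longrightarrow> i \<le> m"
      by (auto simp: finite_nat_set_iff_bounded_le)
    have "g \<in> U" if g: "g \<in> carrier substitution_group" "\<forall>i\<le>m + 2. g $ i = f $ i" for g
    proof -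
      have "substitution_coords g i \<in> W i" for i
      proof (cases "W i = UNIV")
        case False
        with m have "i \<le> m" by blast
        with g(2) have "substitution_coords g i = substitution_coords f i"
          by (simp add: substitution_coords_def)
        with W(2) show ?thesis by (auto simp: PiE_iff)
      qed simp
      then show ?thesis using W(3) U g(1) by (auto simp: PiE_iff)
    qed
    then show ?thesis by blast
  qed
  then show ?R using U by blast
next
  assume R: ?R
  let ?V = "substitution_coords ` U"
  have "\<exists>W. finite {i. W i \<noteq> (UNIV :: 'k set)} \<and> a \<in> PiE UNIV W \<and> PiE UNIV W \<subseteq> ?V"
    if a: "a \<in> ?V" for a
  proof -
    obtain f where f: "f \<in> U" "a = substitution_coords f" using a by auto
    obtain m where m: "\<forall>g\<in>carrier substitution_group. (\<forall>i\<le>m. g $ i = f $ i) \<longrightarrow> g \<in> U"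
      using R f by blast
    define W where "W = (\<lambda>i. if i \<le> m then {a i} else UNIV)"
    have "b \<in> ?V" if b: "b \<in> PiE UNIV W" for b
    proof -
      obtain g where g: "g \<in> carrier substitution_group" "b = substitution_coords g"
        using bij_betw_substitution_coords by (metis UNIV_I bij_betw_iff_bijections)
      have "g $ i = f $ i" if "i \<le> m" for i
      proof -
        consider "i = 0" | "i = 1" | j where "i = j + 2"
          by (metis One_nat_def Suc_1 add.commute add_2_eq_Suc not0_implies_Suc)
        then show ?thesis
        proof cases
          case (3 j)
          then have "b j = a j" using b that by (auto simp: W_def PiE_iff split: if_splits)
          then show ?thesis using 3 by (simp add: f(2) g(2) substitution_coords_def)
        qed (use R f(1) g(1) in \<open>auto simp: substitution_group_def subset_iff\<close>)
      qed
      then show ?thesis using m g by blast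
    qed
    moreover have "finite {i. W i \<noteq> UNIV}"
      by (rule finite_subset[of _ "{..m}"]) (auto simp: W_def)
    moreover have "a \<in> PiE UNIV W" by (auto simp: W_def)
    ultimately show ?thesis by blast
  qed
  then have "openin (product_topology (\<lambda>_. discrete_topology UNIV) UNIV) ?V"
    by (auto simp: openin_product_topology_alt)
  moreover have "U = substitution_coords -` ?V \<inter> carrier substitution_group"
    using R bij_betw_imp_inj_on[OF bij_betw_substitution_coords]
    by (auto dest: inj_onD)
  ultimately show ?L
    by (auto simp: substitution_topology_def openin_pullback_topology)
qed

definition topological_group :: "('a, 'm) monoid_scheme \<Rightarrow> 'a topology \<Rightarrow> bool" where
  "topological_group G T \<longleftrightarrow>
    group G \<and> topspace T = carrier G \<and>
    continuous_map (prod_topology T T) T (\<lambda>(x, y). x \<otimes>\<^bsub>G\<^esub> y) \<and>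
    continuous_map T T (\<lambda>x. inv\<^bsub>G\<^esub> x)"

definition locally_compact_group :: "('a, 'm) monoid_scheme \<Rightarrow> 'a topology \<Rightarrow> bool" where
  "locally_compact_group G T \<longleftrightarrow>
    topological_group G T \<and> locally_compact_space T \<and> Hausdorff_space T"

definition topological_group_embedding ::
  "('a, 'm) monoid_scheme \<Rightarrow> 'a topology \<Rightarrow> ('b, 'n) monoid_scheme \<Rightarrow> 'b topology \<Rightarrow> ('a \<Rightarrow> 'b) \<Rightarrow> bool"
  where
  "topological_group_embedding G S H T \<phi> \<longleftrightarrow> \<phi> \<in> hom G H \<and> embedding_map S T \<phi>"

end

theory Submission
  imports Defs
begin

text \<open>
  A locally compact group is locally precompact: an infinite subset of a compact set clusters, so
  for every neighbourhood \<open>V\<close> of the identity it has two distinct points \<open>x\<close>, \<open>y\<close> with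
  \<open>y x\<^sup>-\<^sup>1 \<in> V\<close> (\<open>infinite_subset_of_compact_near_pair\<close>). Local precompactness passes to subgroups
  and is thus an obstruction to embeddings into locally compact groups.

  The group of substitutions over an infinite discrete ring fails it. If \<open>C\<close> is a compact
  neighbourhood of the identity of \<open>H\<close>, the embedding \<open>\<phi>\<close> maps all series that agree with \<open>x\<close> up to
  some order \<open>m\<close> into \<open>C\<close>, in particular the infinite family \<open>f\<^sub>a = x + a x\<^bsup>m + 2\<^esup>\<close>. Since \<open>\<phi>\<close> is a
  homeomorphism onto its image, some neighbourhood \<open>V\<close> of the identity meets the image only in
  series agreeing with \<open>x\<close> up to order \<open>m + 2\<close>. But the series \<open>u\<close> with \<open>u \<circ> f\<^sub>a = f\<^sub>b\<close>, which is
  sent to \<open>\<phi>(f\<^sub>b) \<phi>(f\<^sub>a)\<^sup>-\<^sup>1\<close>, can agree with \<open>x\<close> to that order only if \<open>a = b\<close>.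
\<close>

text \<open>
  At a cluster point \<open>h\<close> of \<open>A\<close> the map \<open>(x, y) \<mapsto> y x\<^sup>-\<^sup>1\<close> takes \<open>(h, h)\<close> to the identity, so by
  continuity it maps pairs near \<open>h\<close> into \<open>V\<close>; infinitely many points of \<open>A\<close> are near \<open>h\<close>.
\<close>

lemma infinite_subset_of_compact_near_pair:
  assumes H: "topological_group H T" "Hausdorff_space T"
    and C: "compactin T C" and A: "A \<subseteq> C" "infinite A"
    and V: "openin T V" "\<one>\<^bsub>H\<^esub> \<in> V"
  obtains x y where "x \<in> A" "y \<in> A" "x \<noteq> y" "y \<otimes>\<^bsub>H\<^esub> inv\<^bsub>H\<^esub> x \<in> V"
proof -
  interpret group H using H(1) by (simp add: topological_group_def)
  have top: "topspace T = carrier H"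
    and mult: "continuous_map (prod_topology T T) T (\<lambda>(x, y). x \<otimes>\<^bsub>H\<^esub> y)"
    and inv: "continuous_map T T (\<lambda>x. inv\<^bsub>H\<^esub> x)"
    using H(1) by (simp_all add: topological_group_def)
  obtain h where h: "h \<in> T derived_set_of A"
    using compactin_imp_Bolzano_Weierstrass[OF C, of A] A by blast
  then have hH: "h \<in> carrier H"
    using derived_set_of_subset_topspace top by fastforce
  let ?q = "\<lambda>p. snd p \<otimes>\<^bsub>H\<^esub> inv\<^bsub>H\<^esub> (fst p)"
  have "continuous_map (prod_topology T T) (prod_topology T T) (\<lambda>p. (snd p, inv\<^bsub>H\<^esub> (fst p)))"
    by (intro continuous_map_pairedI continuous_map_snd
        continuous_map_compose[OF continuous_map_fst inv, unfolded o_def])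
  from continuous_map_compose[OF this mult]
  have "continuous_map (prod_topology T T) T ?q" by (simp add: o_def)
  then have "openin (prod_topology T T) {p \<in> topspace (prod_topology T T). ?q p \<in> V}"
    using V(1) by (rule openin_continuous_map_preimage)
  moreover have "(h, h) \<in> {p \<in> topspace (prod_topology T T). ?q p \<in> V}"
    using V(2) hH top by simp
  ultimately obtain W1 W2 where W: "openin T W1" "openin T W2" "h \<in> W1" "h \<in> W2"
    "W1 \<times> W2 \<subseteq> {p \<in> topspace (prod_topology T T). ?q p \<in> V}"
    unfolding openin_prod_topology_alt by meson
  have inf: "infinite (A \<inter> (W1 \<inter> W2))"
    using h W(1-4) derived_set_of_infinite_openin[OF H(2), of A] by (auto simp: Int_ac)
  obtain x where x: "x \<in> A \<inter> (W1 \<inter> W2)"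
    using infinite_imp_nonempty[OF inf] by blast
  have "infinite (A \<inter> (W1 \<inter> W2) - {x})" using inf by simp
  from infinite_imp_nonempty[OF this] obtain y where y: "y \<in> A \<inter> (W1 \<inter> W2)" "x \<noteq> y"
    by blast
  have "(x, y) \<in> W1 \<times> W2" using x y by blast
  then have "y \<otimes>\<^bsub>H\<^esub> inv\<^bsub>H\<^esub> x \<in> V" using W(5) by auto
  then show ?thesis using that x y by blast
qed

text \<open>
  Comparing coefficients in \<open>u \<circ> f = g\<close> gives a linear system for the coefficients of \<open>u\<close>. It is
  triangular with unit diagonal because \<open>f\<^sup>i = x\<^sup>i + \<dots>\<close>, and so is solved recursively over any
  commutative ring.
\<close>

fun left_quotient_coeff :: "'k::comm_ring_1 fps \<Rightarrow> 'k fps \<Rightarrow> nat \<Rightarrow> 'k" where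
  "left_quotient_coeff g f n = g $ n - (\<Sum>i<n. left_quotient_coeff g f i * (f ^ i) $ n)"

declare left_quotient_coeff.simps [simp del]

lemma power_nth_same:
  fixes f :: "'k::comm_ring_1 fps"
  assumes "f $ 0 = 0" "f $ 1 = 1"
  shows "(f ^ n) $ n = 1"
  using startsby_zero_power_nth_same[OF assms(1), of n] assms(2) by simp

lemma ex_left_quotient:
  fixes f g :: "'k::comm_ring_1 fps"
  assumes f: "f \<in> carrier substitution_group" and g: "g \<in> carrier substitution_group"
  obtains u where "u \<in> carrier substitution_group" "u oo f = g"
proof
  let ?u = "Abs_fps (left_quotient_coeff g f)"
  have f01: "f $ 0 = 0" "f $ 1 = 1" and g01: "g $ 0 = 0" "g $ 1 = 1"
    using f g by (simp_all add: substitution_group_def)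
  show "?u oo f = g"
  proof (rule fps_ext)
    fix n
    have "(?u oo f) $ n = (\<Sum>i<Suc n. left_quotient_coeff g f i * (f ^ i) $ n)"
      by (simp add: fps_compose_nth atLeast0AtMost lessThan_Suc_atMost)
    also have "\<dots> = g $ n"
      using power_nth_same[OF f01, of n] by (simp add: left_quotient_coeff.simps[of g f n])
    finally show "(?u oo f) $ n = g $ n" .
  qed
  have "left_quotient_coeff g f 0 = 0"
    using g01 by (simp add: left_quotient_coeff.simps[of g f 0])
  moreover from this have "left_quotient_coeff g f (Suc 0) = 1"
    using g01 by (simp add: left_quotient_coeff.simps[of g f "Suc 0"])
  ultimately show "?u \<in> carrier substitution_group"
    by (simp add: substitution_group_def)
qed

lemma compose_nth_cong_left:
  fixes u v f :: "'k::comm_ring_1 fps"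
  assumes "\<forall>i\<le>n. u $ i = v $ i"
  shows "(u oo f) $ n = (v oo f) $ n"
  using assms by (simp add: fps_compose_nth)

lemma openin_agree_upto:
  fixes g :: "'k::comm_ring_1 fps"
  shows "openin (substitution_topology (discrete_topology UNIV))
    {f \<in> carrier substitution_group. \<forall>i\<le>m. f $ i = g $ i}"
  unfolding openin_substitution_topology_discrete by (auto intro!: exI[of _ m])

lemma topspace_substitution_topology_discrete:
  "topspace (substitution_topology (discrete_topology (UNIV :: 'k::comm_ring_1 set))) =
    carrier substitution_group"
  by (simp add: substitution_topology_def topspace_pullback_topology)

theorem theorem1:
  fixes H :: "'h monoid" and T :: "'h topology"
  assumes "infinite (UNIV :: 'k::comm_ring_1 set)"
    and "locally_compact_group H T"
  shows "\<nexists>\<phi>. topological_group_embedding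
      (substitution_group :: 'k fps monoid)
      (substitution_topology (discrete_topology (UNIV :: 'k set))) H T \<phi>"
proof
  let ?J = "substitution_group :: 'k fps monoid"
  let ?S = "substitution_topology (discrete_topology (UNIV :: 'k set))"
  assume "\<exists>\<phi>. topological_group_embedding ?J ?S H T \<phi>"
  then obtain \<phi> where hom: "\<phi> \<in> hom ?J H" and emb: "embedding_map ?S T \<phi>"
    by (auto simp: topological_group_embedding_def)
  have tg: "topological_group H T" and haus: "Hausdorff_space T"
    and lc: "locally_compact_space T"
    using assms(2) by (simp_all add: locally_compact_group_def)
  interpret group H using tg by (simp add: topological_group_def)
  have top: "topspace T = carrier H" using tg by (simp add: topological_group_def)
  have closed: "\<phi> f \<in> carrier H" if "f \<in> carrier ?J" for f
    using hom that by (auto simp: hom_def)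
  have \<phi>_compose: "\<phi> (u oo f) = \<phi> u \<otimes>\<^bsub>H\<^esub> \<phi> f"
    if "u \<in> carrier ?J" "f \<in> carrier ?J" for u f
    using hom_mult[OF hom that] by (simp add: substitution_group_def)
  have X: "fps_X \<in> carrier ?J" by (simp add: substitution_group_def)
  have \<phi>_X: "\<phi> fps_X = \<one>\<^bsub>H\<^esub>"
    using \<phi>_compose[OF X X] closed[OF X] l_cancel_one' by simp
  have homeo: "homeomorphic_map ?S (subtopology T (\<phi> ` carrier ?J)) \<phi>"
    using emb by (simp add: embedding_map_def topspace_substitution_topology_discrete)
  then have inj: "inj_on \<phi> (carrier ?J)"
    by (simp add: homeomorphic_eq_everything_map topspace_substitution_topology_discrete)
  obtain U C where U: "openin T U" and C: "compactin T C" and "\<one>\<^bsub>H\<^esub> \<in> U" "U \<subseteq> C"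
    using lc one_closed top unfolding locally_compact_space_def by metis
  have "openin ?S {f \<in> topspace ?S. \<phi> f \<in> U}"
    using continuous_map_into_fulltopology[OF homeomorphic_imp_continuous_map[OF homeo]] U
    by (rule openin_continuous_map_preimage)
  moreover have "fps_X \<in> {f \<in> topspace ?S. \<phi> f \<in> U}"
    using X \<phi>_X \<open>\<one>\<^bsub>H\<^esub> \<in> U\<close> by (simp add: topspace_substitution_topology_discrete)
  ultimately obtain m where m: "\<And>g. \<lbrakk>g \<in> carrier ?J; \<forall>i\<le>m. g $ i = fps_X $ i\<rbrakk> \<Longrightarrow> \<phi> g \<in> U"
    unfolding openin_substitution_topology_discrete by blast
  \<comment> \<open>The exponent exceeds \<open>m\<close>, and also \<open>1\<close>, so that the linear coefficient stays \<open>1\<close>.\<close>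
  define F :: "'k \<Rightarrow> 'k fps" where "F a = fps_X + fps_const a * fps_X ^ (m + 2)" for a
  have F_nth: "F a $ i = (if i = 1 then 1 else if i = m + 2 then a else 0)" for a i
    by (auto simp: F_def simp del: power_Suc)
  have FJ: "F a \<in> carrier ?J" for a
    by (simp add: F_nth substitution_group_def)
  have "\<phi> ` range F \<subseteq> C"
  proof clarify
    fix a
    show "\<phi> (F a) \<in> C"
      using m[OF FJ[of a]] \<open>U \<subseteq> C\<close> by (auto simp: F_nth)
  qed
  moreover have "infinite (\<phi> ` range F)"
  proof -
    have "F a $ (m + 2) = a" for a by (simp add: F_nth)
    then have "inj F" by (metis injI)
    then have "infinite (range F)" using assms(1) finite_imageD by blast
    moreover have "inj_on \<phi> (range F)" using inj FJ by (blast intro: inj_on_subset)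
    ultimately show ?thesis using finite_imageD by blast
  qed
  moreover
  define N where "N = {f \<in> carrier ?J. \<forall>i\<le>m + 2. f $ i = fps_X $ i}"
  have "openin (subtopology T (\<phi> ` carrier ?J)) (\<phi> ` N)"
    using homeomorphic_imp_open_map[OF homeo] openin_agree_upto[of "m + 2" fps_X]
    unfolding open_map_def N_def by blast
  then obtain V where V: "openin T V" and \<phi>N: "\<phi> ` N = V \<inter> \<phi> ` carrier ?J"
    by (auto simp: openin_subtopology)
  have "\<one>\<^bsub>H\<^esub> \<in> \<phi> ` N" using X \<phi>_X by (force simp: N_def)
  then have "\<one>\<^bsub>H\<^esub> \<in> V" using \<phi>N by blast
  ultimately obtain x y where xy: "x \<in> \<phi> ` range F" "y \<in> \<phi> ` range F" "x \<noteq> y"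
    "y \<otimes>\<^bsub>H\<^esub> inv\<^bsub>H\<^esub> x \<in> V"
    using infinite_subset_of_compact_near_pair[OF tg haus C _ _ V] by blast
  obtain a b where "x = \<phi> (F a)" "y = \<phi> (F b)" using xy(1,2) by blast
  then have "a \<noteq> b" and ab: "\<phi> (F b) \<otimes>\<^bsub>H\<^esub> inv\<^bsub>H\<^esub> \<phi> (F a) \<in> V"
    using xy(3,4) by auto
  obtain u where u: "u \<in> carrier ?J" "u oo F a = F b"
    using ex_left_quotient[OF FJ FJ] by blast
  have "\<phi> u = \<phi> (F b) \<otimes>\<^bsub>H\<^esub> inv\<^bsub>H\<^esub> \<phi> (F a)"
    using \<phi>_compose[OF u(1) FJ[of a]] u(2) closed[OF u(1)] closed[OF FJ[of a]]
    by (simp add: m_assoc)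
  then have "\<phi> u \<in> V" using ab by simp
  then have "\<phi> u \<in> \<phi> ` N" unfolding \<phi>N using u(1) by blast
  moreover have "N \<subseteq> carrier ?J" unfolding N_def by blast
  ultimately have "u \<in> N" using inj_on_image_mem_iff[OF inj u(1)] by blast
  then have "(u oo F a) $ (m + 2) = (fps_X oo F a) $ (m + 2)"
    by (intro compose_nth_cong_left) (simp add: N_def)
  also have "fps_X oo F a = F a"
    using FJ[of a] by (simp add: substitution_group_def)
  finally have "a = b" using u(2) by (simp add: F_nth)
  with \<open>a \<noteq> b\<close> show False by contradiction
qed

end
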